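(* Let $W:\mathbb{R}^2\to\mathbb{R}$ be a measurable function satisfying $W(q,p)\ge 0$ and $\pi W(q,p)\le 1$ for all $(q,p)$, and $\int_{\mathbb{R}^2} W(q,p)\,dq\,dp=1$. Let $\mu:=2\pi\int_{\mathbb{R}^2}W(q,p)^2\,dq\,dp$, and for each integer $n\ge 1$ let $$B_n:=\ln\pi+\int_{\mathbb{R}^2} W(q,p)\sum_{k=1}^n\frac{(-1)^k}{k}\bigl(\pi W(q,p)-1\bigr)^k\,dq\,dp .$$ Then for every integer $n\ge 2$, $$B_n\;\ge\;\ln\pi+\sum_{k=1}^n\frac1k\left(1-\frac{\mu}{2}\right)^k .$$
   Context: The quantity $\mu$ is called the purity of $W$. Every Wigner function of a single-mode quantum state that is everywhere non-negative satisfies the hypotheses, but $W$ is not required to be the Wigner function of a quantum state. *)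

theory Defs
  imports "HOL-Analysis.Analysis"
begin

text \<open>
  A non-integrable function has Bochner integral 0, so the two integrals below are meaningful
  only if their integrands are integrable. This holds when W is measurable and nonnegative
  with pi * W bounded by 1 and total integral 1 (nonzero, hence W is integrable).
\<close>

definition purity :: "(real \<times> real \<Rightarrow> real) \<Rightarrow> real" where
  "purity W = 2 * pi * (LINT x|lebesgue. (W x)\<^sup>2)"

definition B :: "(real \<times> real \<Rightarrow> real) \<Rightarrow> nat \<Rightarrow> real" where
  "B W n = ln pi +
     (LINT x|lebesgue. W x * (\<Sum>k=1..n. (-1) ^ k / real k * (pi * W x - 1) ^ k))"

end

theory Submission
  imports Defs
begin

text \<open>
  Write \<open>u = 1 - \<pi> W\<close>, which takes values in \<open>[0, 1]\<close>. Under the probability density \<open>W\<close> the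
  mean of \<open>u\<close> is \<open>m = 1 - \<mu>/2\<close>, and the integrand of \<open>B\<^sub>n\<close> is \<open>W f(u)\<close> with the convex function
  \<open>f(u) = \<Sum>\<^bsub>k\<le>n\<^esub> u\<^sup>k/k\<close>. The claim is Jensen's inequality, obtained by integrating
  against \<open>W\<close> the bound of \<open>f\<close> from below by its tangent at \<open>m\<close>.
\<close>

text \<open>Multiplying the bound for exponent \<open>Suc j\<close> by \<open>u\<close> gives the
  next tangent line plus the error \<open>of_nat (Suc j) * m ^ j * (u - m)\<^sup>2\<close>, which is
  nonnegative; hence an induction without derivatives.\<close>

lemma power_Suc_ge_tangent:
  fixes u m :: "'a::linordered_idom"
  assumes "u \<ge> 0" "m \<ge> 0"
  shows "u ^ Suc j \<ge> m ^ Suc j + of_nat (Suc j) * m ^ j * (u - m)"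
proof (induction j)
  case 0
  then show ?case by simp
next
  case (Suc j)
  have "m ^ Suc (Suc j) + of_nat (Suc (Suc j)) * m ^ Suc j * (u - m)
      = u * (m ^ Suc j + of_nat (Suc j) * m ^ j * (u - m)) - of_nat (Suc j) * m ^ j * (u - m)\<^sup>2"
    by (simp add: algebra_simps power2_eq_square)
  also have "\<dots> \<le> u * (m ^ Suc j + of_nat (Suc j) * m ^ j * (u - m))"
    using assms by (simp del: of_nat_Suc)
  also have "\<dots> \<le> u * u ^ Suc j"
    using Suc.IH assms(1) by (rule mult_left_mono)
  finally show ?case by simp
qed

text \<open>The weight \<open>1 / real k\<close> cancels the factor \<open>k\<close> in the slope of
  the k-th power, leaving \<open>m ^ (k - 1)\<close>.\<close>

lemma sum_power_div_ge_tangent: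
  fixes u m :: real
  assumes "u \<ge> 0" "m \<ge> 0"
  shows "(\<Sum>k=1..n. 1 / real k * u ^ k)
      \<ge> (\<Sum>k=1..n. 1 / real k * m ^ k) + (\<Sum>k=1..n. m ^ (k - 1)) * (u - m)"
proof -
  have "1 / real k * m ^ k + m ^ (k - 1) * (u - m) \<le> 1 / real k * u ^ k" if k_in: "k \<in> {1..n}" for k
  proof -
    obtain j where k: "k = Suc j" using k_in by (cases k) simp_all
    have "1 / real k * (m ^ k + real k * m ^ (k - 1) * (u - m)) \<le> 1 / real k * u ^ k"
      using power_Suc_ge_tangent[OF assms, of j] unfolding k
      by (intro mult_left_mono) simp_all
    moreover have "1 / real k * (m ^ k + real k * m ^ (k - 1) * (u - m))
        = 1 / real k * m ^ k + m ^ (k - 1) * (u - m)"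
      unfolding k by (simp add: field_simps del: of_nat_Suc)
    ultimately show ?thesis by simp
  qed
  then show ?thesis
    unfolding sum_distrib_right sum.distrib[symmetric] by (rule sum_mono)
qed

theorem mainTheorem2:
  fixes W :: "real \<times> real \<Rightarrow> real" and n :: nat
  assumes "W \<in> borel_measurable lebesgue"
    and "\<And>q p. W (q, p) \<ge> 0"
    and "\<And>q p. pi * W (q, p) \<le> 1"
    and "(LINT x|lebesgue. W x) = 1"
    and "n \<ge> 2"
  shows "B W n \<ge> ln pi + (\<Sum>k=1..n. 1 / real k * (1 - purity W / 2) ^ k)"
proof -
  define u where "u x = 1 - pi * W x" for x
  define m where "m = 1 - purity W / 2"
  \<comment> \<open>The derivative of \<open>f\<close> at \<open>m\<close>.\<close>
  define c where "c = (\<Sum>k=1..n. m ^ (k - 1))"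
  define f where "f t = (\<Sum>k=1..n. 1 / real k * t ^ k)" for t
  have meas [measurable]: "W \<in> borel_measurable lebesgue" by fact
  have W0: "W x \<ge> 0" for x using assms(2) by (cases x) simp
  have u0: "u x \<ge> 0" for x using assms(3) by (cases x) (simp add: u_def)
  have u1: "u x \<le> 1" for x using W0[of x] by (simp add: u_def)
  have intW: "integrable lebesgue W"
    using assms(4) not_integrable_integral_eq by fastforce
  have intWuk: "integrable lebesgue (\<lambda>x. W x * u x ^ k)" for k
  proof (rule Bochner_Integration.integrable_bound[OF intW])
    show "(\<lambda>x. W x * u x ^ k) \<in> borel_measurable lebesgue"
      unfolding u_def by measurable
    have "W x * u x ^ k \<le> W x" for x
      using W0 u0 u1 by (simp add: mult_left_le power_le_one)
    then show "AE x in lebesgue. norm (W x * u x ^ k) \<le> norm (W x)"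
      using W0 u0 by (simp add: abs_mult)
  qed
  have intWu: "integrable lebesgue (\<lambda>x. W x * u x)"
    using intWuk[of 1] by simp
  have mean: "(LINT x|lebesgue. W x * u x) = m"
  proof -
    \<comment> \<open>The left side is half the purity, that is \<open>1 - m\<close>.\<close>
    have "(LINT x|lebesgue. pi * (W x)\<^sup>2) = (LINT x|lebesgue. W x - W x * u x)"
      by (simp add: u_def algebra_simps power2_eq_square)
    also have "\<dots> = 1 - (LINT x|lebesgue. W x * u x)"
      using intW intWu assms(4) by simp
    finally show ?thesis
      by (simp add: m_def purity_def)
  qed
  \<comment> \<open>The tangent bound holds only for a nonnegative base point; here \<open>m\<close>
    is a mean of \<open>u \<ge> 0\<close>.\<close>
  have m0: "m \<ge> 0"
    unfolding mean[symmetric] using W0 u0 by (simp add: integral_nonneg_AE)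
  have intWf: "integrable lebesgue (\<lambda>x. W x * f (u x))"
    unfolding f_def sum_distrib_left mult.left_commute[of "W _"]
    using intWuk by (intro Bochner_Integration.integrable_sum integrable_mult_right)
  have "B W n = ln pi + (LINT x|lebesgue. W x * f (u x))"
  proof -
    \<comment> \<open>The alternating sign turns powers of \<open>pi * W x - 1\<close> into powers
      of \<open>u x\<close>.\<close>
    have "(-1) ^ k / real k * (pi * W x - 1) ^ k = 1 / real k * u x ^ k" for k x
      unfolding u_def by (simp flip: power_mult_distrib)
    then show ?thesis unfolding B_def f_def by presburger
  qed
  moreover have "f m \<le> (LINT x|lebesgue. W x * f (u x))"
  proof -
    \<comment> \<open>Since \<open>W\<close> has mass 1 and \<open>u\<close> has mean
      \<open>m\<close>, the linear term of the tangent integrates to 0.\<close>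
    have "f m = (LINT x|lebesgue. (f m - c * m) * W x + c * (W x * u x))"
      using intW intWu assms(4) mean by simp
    also have "\<dots> = (LINT x|lebesgue. W x * (f m + c * (u x - m)))"
      by (simp add: algebra_simps)
    also have "\<dots> \<le> (LINT x|lebesgue. W x * f (u x))"
    proof (rule integral_mono[OF _ intWf])
      have "integrable lebesgue (\<lambda>x. (f m - c * m) * W x + c * (W x * u x))"
        using intW intWu by simp
      then show "integrable lebesgue (\<lambda>x. W x * (f m + c * (u x - m)))"
        by (simp add: algebra_simps)
      show "W x * (f m + c * (u x - m)) \<le> W x * f (u x)" for x
        unfolding f_def c_def
        by (intro mult_left_mono sum_power_div_ge_tangent u0 m0 W0)
    qed
    finally show ?thesis .
  qed
  ultimately show ?thesis
    by (simp add: f_def m_def)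
qed

end
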